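(* For integers $r,t\ge 2$ there is a constant $C = C(r,t)$ such that, for $n$ sufficiently large, every $2$-edge-coloring of $K_n$ with at least $C$ edges in each color class and without a monochromatic induced $rK_2$ contains an induced monochromatic $K_{1,t}$.
   Context: A $2$-edge-coloring of $K_n$ is a partition $E(K_n)=E(R)\cup E(B)$ into red and blue edges. The coloring contains an induced monochromatic copy of a graph $H$ if there is $U\subseteq V(K_n)$ with $|U|=|V(H)|$ such that the red edges inside $U$, or the blue edges inside $U$, form a graph isomorphic to $H$. $rK_2$ is a matching with $r$ edges; $K_{1,t}$ is the star with $t$ leaves. *)

theory Defs
  imports Main
begin

text \<open>A graph is a pair of a vertex set and a set of edges, the edges being two-element
  sets of vertices.\<close>

type_synonym 'a graph = "'a set \<times> 'a set set"

abbreviation verts :: "'a graph \<Rightarrow> 'a set" where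
  "verts \<equiv> fst"

abbreviation edges :: "'a graph \<Rightarrow> 'a set set" where
  "edges \<equiv> snd"

definition graph_isomorphic :: "'a graph \<Rightarrow> 'b graph \<Rightarrow> bool" where
  "graph_isomorphic G H \<longleftrightarrow>
     (\<exists>f. bij_betw f (verts G) (verts H) \<and> (\<lambda>e. f ` e) ` edges G = edges H)"

definition complete_graph :: "nat \<Rightarrow> nat graph" where
  "complete_graph n = ({..<n}, {e. e \<subseteq> {..<n} \<and> card e = 2})"

definition matching_graph :: "nat \<Rightarrow> (nat \<times> bool) graph" where
  "matching_graph r = ({..<r} \<times> UNIV, {{(i, False), (i, True)} | i. i < r})"

text \<open>The centre of the star is \<open>0\<close>, its leaves are \<open>1, \<dots>, t\<close>.\<close>

definition star_graph :: "nat \<Rightarrow> nat graph" where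
  "star_graph t = ({..t}, {{0, i} | i. i \<in> {1..t}})"

definition two_edge_coloring :: "nat \<Rightarrow> nat set set \<Rightarrow> nat set set \<Rightarrow> bool" where
  "two_edge_coloring n R B \<longleftrightarrow> R \<union> B = edges (complete_graph n) \<and> R \<inter> B = {}"

definition edges_inside :: "'a set set \<Rightarrow> 'a set \<Rightarrow> 'a set set" where
  "edges_inside E U = {e \<in> E. e \<subseteq> U}"

text \<open>Only one of the two colours has to induce \<open>H\<close> on \<open>U\<close>; the remaining pairs inside \<open>U\<close>
  then carry the other colour.\<close>

definition contains_induced_mono :: 
  "nat \<Rightarrow> nat set set \<Rightarrow> nat set set \<Rightarrow> 'a graph \<Rightarrow> bool" where
  "contains_induced_mono n R B H \<longleftrightarrow>
     (\<exists>U \<subseteq> verts (complete_graph n). card U = card (verts H) \<and>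
        (graph_isomorphic (U, edges_inside R U) H \<or> graph_isomorphic (U, edges_inside B U) H))"

end

theory Submission imports Defs "HOL-Library.Ramsey" "HOL-Library.Disjoint_Sets" begin

text \<open>By Ramsey's theorem a large colouring has a large clique \<open>A\<close> in one colour, say \<open>F\<close>; let
  \<open>E\<close> be the other colour. Without an induced star in \<open>E\<close>, every vertex outside \<open>A\<close> has fewer
  than \<open>t\<close> neighbours in \<open>A\<close> with respect to \<open>E\<close>. So \<open>t\<close> vertices outside \<open>A\<close> forming an
  \<open>E\<close>-clique would have a common \<open>F\<close>-neighbour in \<open>A\<close>, which gives an induced star in \<open>F\<close>.
  Hence \<open>E\<close> has no clique on \<open>t + 1\<close> vertices, and neighbourhoods in \<open>E\<close> contain no \<open>F\<close>-clique
  on \<open>t\<close> vertices, so by Ramsey's theorem again the degrees in \<open>E\<close> are bounded. A graph of bounded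
  degree with many edges contains a large induced matching.\<close>

section \<open>Neighbourhoods, and recognising induced stars and matchings\<close>

definition nbrs :: "'a set set \<Rightarrow> 'a \<Rightarrow> 'a set" where
  "nbrs E v = {w. {v, w} \<in> E}"

lemma finite_nbrs:
  assumes "finite E"
  shows "finite (nbrs E v)"
proof (rule finite_imageD)
  show "finite ((\<lambda>w. {v, w}) ` nbrs E v)"
    using assms by (rule rev_finite_subset) (auto simp: nbrs_def)
  show "inj_on (\<lambda>w. {v, w}) (nbrs E v)"
    by (auto simp: inj_on_def doubleton_eq_iff)
qed

text \<open>Bijections are easiest to write down from the fixed star or matching into the host
  graph, whereas \<open>contains_induced_mono\<close> asks for the opposite direction. As edges lie
  within the vertex set, the inverse of \<open>g\<close> undoes \<open>g\<close> on every
  edge.\<close>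

lemma graph_isomorphic_inv:
  assumes g: "bij_betw g (verts H) (verts G)" and im: "(\<lambda>e. g ` e) ` edges H = edges G"
    and sub: "\<Union> (edges H) \<subseteq> verts H"
  shows "graph_isomorphic G H"
proof -
  let ?f = "inv_into (verts H) g"
  have "?f ` g ` e = e" if "e \<in> edges H" for e
  proof -
    have "e \<subseteq> verts H"
      using sub that by blast
    then show ?thesis
      using bij_betw_imp_inj_on[OF g] by simp
  qed
  then have "(\<lambda>e. ?f ` e) ` (\<lambda>e. g ` e) ` edges H = edges H"
    by (simp add: image_image)
  then show ?thesis
    unfolding graph_isomorphic_def using bij_betw_inv_into[OF g] im by metis
qed

text \<open>Describing the copy by its centre and leaves means that a star is obtained as soon as
  \<open>t\<close> pairwise non-adjacent vertices are found in one neighbourhood.\<close>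

definition induced_star :: "nat \<Rightarrow> 'a set set \<Rightarrow> 'a \<Rightarrow> 'a set \<Rightarrow> bool" where
  "induced_star t E v L \<longleftrightarrow> v \<notin> L \<and> card L = t \<and> L \<subseteq> nbrs E v \<and> indep L E"

lemma induced_star_isomorphic:
  assumes star: "induced_star t E v L" and "t > 0" and card2: "\<forall>e\<in>E. card e = 2"
  shows "card (insert v L) = card (verts (star_graph t))"
    and "graph_isomorphic (insert v L, edges_inside E (insert v L)) (star_graph t)"
proof -
  from star have v: "v \<notin> L" and L: "card L = t" and nb: "\<And>w. w \<in> L \<Longrightarrow> {v, w} \<in> E"
    and ind: "indep L E"
    by (auto simp: induced_star_def nbrs_def)
  \<comment> \<open>An infinite set has \<open>card\<close> equal to 0, so finiteness of the leaf
    set comes from \<open>t > 0\<close>.\<close>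
  have fin: "finite L"
    using L \<open>t > 0\<close> card.infinite by fastforce
  show "card (insert v L) = card (verts (star_graph t))"
    using fin v L by (simp add: star_graph_def)
  obtain h where h: "bij_betw h {1..t} L"
    using finite_same_card_bij[of "{1..t}" L] fin L by auto
  define g where "g = (\<lambda>i::nat. if i = 0 then v else h i)"
  have gh: "g ` {1..t} = L"
    using bij_betw_imp_surj_on[OF h] by (auto simp: g_def)
  have "bij_betw g {1..t} L"
    using h by (rule bij_betw_cong[THEN iffD1, rotated]) (auto simp: g_def)
  then have "bij_betw g ({0} \<union> {1..t}) ({v} \<union> L)"
    by (intro bij_betw_combine) (use v in \<open>auto simp: g_def\<close>)
  moreover have "{0} \<union> {1..t} = {..t}"
    by auto
  ultimately have bij: "bij_betw g (verts (star_graph t)) (insert v L)"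
    by (simp add: star_graph_def)
  have "edges (star_graph t) = (\<lambda>i. {0, i}) ` {1..t}"
    by (auto simp: star_graph_def)
  then have "(\<lambda>e. g ` e) ` edges (star_graph t) = (\<lambda>i. {v, g i}) ` {1..t}"
    by (simp add: image_image) (simp add: g_def)
  also have "\<dots> = (\<lambda>w. {v, w}) ` L"
    by (simp flip: gh add: image_image)
  also have "\<dots> = edges_inside E (insert v L)"
  proof
    show "(\<lambda>w. {v, w}) ` L \<subseteq> edges_inside E (insert v L)"
      using nb by (auto simp: edges_inside_def)
    show "edges_inside E (insert v L) \<subseteq> (\<lambda>w. {v, w}) ` L"
    proof
      fix e assume "e \<in> edges_inside E (insert v L)"
      then have e: "e \<in> E" "e \<subseteq> insert v L"
        by (auto simp: edges_inside_def)
      then obtain x y where xy: "e = {x, y}" "x \<noteq> y"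
        using card2 by (metis card_2_iff)
      then have "x = v \<or> y = v"
        using e ind by (auto simp: indep_def)
      then show "e \<in> (\<lambda>w. {v, w}) ` L"
        using xy e by auto
    qed
  qed
  finally show "graph_isomorphic (insert v L, edges_inside E (insert v L)) (star_graph t)"
    using bij by (intro graph_isomorphic_inv[of g]) (auto simp: star_graph_def)
qed

text \<open>The last hypothesis expresses inducedness: no edge of \<open>E\<close> joins two
  different members of \<open>M\<close>. Disjointness makes the endpoint map injective across
  different members.\<close>

lemma induced_matching_isomorphic:
  assumes "finite M" "card M = r" and dis: "disjoint M" and card2: "\<forall>e\<in>M. card e = 2"
    and M: "edges_inside E (\<Union>M) = M"
  shows "card (\<Union>M) = card (verts (matching_graph r))"
    and "graph_isomorphic (\<Union>M, edges_inside E (\<Union>M)) (matching_graph r)"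
proof -
  obtain h where h: "bij_betw h {..<r} M"
    using finite_same_card_bij[of "{..<r}" M] assms by auto
  have "\<forall>e\<in>M. \<exists>p. e = {fst p, snd p} \<and> fst p \<noteq> snd p"
    using card2 by (auto simp: card_2_iff)
  then obtain p where p: "\<And>e. e \<in> M \<Longrightarrow> e = {fst (p e), snd (p e)} \<and> fst (p e) \<noteq> snd (p e)"
    by metis
  \<comment> \<open>Each edge gets an arbitrary orientation through \<open>p\<close>; the Boolean
    selects the endpoint.\<close>
  define g where "g = (\<lambda>(i, b). if b then snd (p (h i)) else fst (p (h i)))"
  have hM: "h i \<in> M" if "i < r" for i
    using h that by (auto simp: bij_betw_def)
  have edge: "{g (i, False), g (i, True)} = h i" "g (i, False) \<noteq> g (i, True)" if "i < r" for i
    using p[OF hM[OF that]] by (auto simp: g_def)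
  have mem: "g (i, b) \<in> h i" if "i < r" for i b
    using edge(1)[OF that] by (cases b) auto
  have img: "(\<lambda>e. g ` e) ` edges (matching_graph r) = M"
  proof -
    have "edges (matching_graph r) = (\<lambda>i. {(i, False), (i, True)}) ` {..<r}"
      by (auto simp: matching_graph_def)
    then have "(\<lambda>e. g ` e) ` edges (matching_graph r) = (\<lambda>i. {g (i, False), g (i, True)}) ` {..<r}"
      by (simp add: image_image)
    also have "\<dots> = h ` {..<r}"
      by (intro image_cong) (simp_all add: edge)
    finally show ?thesis
      using h by (simp add: bij_betw_def)
  qed
  have "inj_on g ({..<r} \<times> UNIV)"
  proof (rule inj_onI, clarify)
    fix i b j c assume ij: "i < r" "j < r" and eq: "g (i, b) = g (j, c)"
    have "h i \<inter> h j \<noteq> {}"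
      using mem[OF ij(1), of b] mem[OF ij(2), of c] eq by auto
    then have "h i = h j"
      using dis hM ij by (metis disjointD)
    then have "i = j"
      using h ij by (auto simp: bij_betw_def inj_on_def)
    moreover have "b = c"
      using eq edge(2)[OF ij(1)] \<open>i = j\<close> by (cases b; cases c) auto
    ultimately show "i = j \<and> b = c"
      by simp
  qed
  moreover have "g ` ({..<r} \<times> UNIV) = \<Union>M"
  proof -
    have "g ` ({..<r} \<times> UNIV) = (\<Union>i<r. {g (i, False), g (i, True)})"
      by (force simp: UNIV_bool)
    also have "\<dots> = \<Union> (h ` {..<r})"
      using edge(1) by auto
    finally show ?thesis
      using h by (simp add: bij_betw_def)
  qed
  ultimately have bij: "bij_betw g (verts (matching_graph r)) (\<Union>M)"
    by (simp add: bij_betw_def matching_graph_def)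
  then show "card (\<Union>M) = card (verts (matching_graph r))"
    by (simp add: bij_betw_same_card)
  show "graph_isomorphic (\<Union>M, edges_inside E (\<Union>M)) (matching_graph r)"
    by (rule graph_isomorphic_inv[of g]) (use bij img M in \<open>auto simp: matching_graph_def\<close>)
qed

section \<open>Induced matchings in graphs of bounded degree\<close>

lemma card_edges_meeting_le:
  assumes "finite E" and card2: "\<forall>e\<in>E. card e = 2" and deg: "\<forall>v. card (nbrs E v) \<le> d"
    and "finite S"
  shows "card {e \<in> E. e \<inter> S \<noteq> {}} \<le> card S * d"
proof -
  have "{e \<in> E. e \<inter> S \<noteq> {}} \<subseteq> (\<Union>s\<in>S. (\<lambda>w. {s, w}) ` nbrs E s)"
  proof
    fix e assume "e \<in> {e \<in> E. e \<inter> S \<noteq> {}}"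
    then obtain s where s: "e \<in> E" "s \<in> e" "s \<in> S"
      by auto
    then obtain w where "e = {s, w}"
      using card2 by (metis card_2_iff insert_commute insertE singletonD)
    then show "e \<in> (\<Union>s\<in>S. (\<lambda>w. {s, w}) ` nbrs E s)"
      using s by (auto simp: nbrs_def)
  qed
  then have "card {e \<in> E. e \<inter> S \<noteq> {}} \<le> card (\<Union>s\<in>S. (\<lambda>w. {s, w}) ` nbrs E s)"
    by (intro card_mono) (simp_all add: assms finite_nbrs)
  also have "\<dots> \<le> (\<Sum>s\<in>S. card ((\<lambda>w. {s, w}) ` nbrs E s))"
    using \<open>finite S\<close> by (rule card_UN_le)
  also have "\<dots> \<le> (\<Sum>s\<in>S. d)"
    using deg finite_nbrs[OF \<open>finite E\<close>] by (intro sum_mono) (metis card_image_le le_trans)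
  finally show ?thesis
    by simp
qed

text \<open>Greedy choice: take an edge, discard every edge meeting the neighbourhood of one of its
  ends, and repeat. The ends have at most \<open>2 * d\<close> neighbours altogether, each on at
  most \<open>d\<close> edges, so a round costs at most \<open>2 * d * d\<close> edges.\<close>

lemma ex_induced_matching:
  assumes "finite E" and "\<forall>e\<in>E. card e = 2" and "\<forall>v. card (nbrs E v) \<le> d"
    and "r * (2 * d * d + 1) \<le> card E"
  shows "\<exists>M\<subseteq>E. card M = r \<and> disjoint M \<and> edges_inside E (\<Union>M) = M"
  using assms
proof (induction r arbitrary: E)
  case 0
  have "edges_inside E {} = {}"
    using "0.prems"(2) by (auto simp: edges_inside_def)
  then show ?case
    by (intro exI[of _ "{}"]) auto
next
  case (Suc r)
  note fin = \<open>finite E\<close> and card2 = Suc.prems(2) and deg = Suc.prems(3)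
  \<comment> \<open>The summand 1 in the bound keeps it positive even when \<open>d\<close> is
    0.\<close>
  have "E \<noteq> {}"
    using Suc.prems(4) by auto
  then obtain a b where ab: "{a, b} \<in> E" "a \<noteq> b"
    using card2 by (metis card_2_iff ex_in_conv)
  \<comment> \<open>Since \<open>a\<close> and \<open>b\<close> are adjacent, \<open>S\<close>
    contains both of them, so edges avoiding \<open>S\<close> also avoid the chosen edge.\<close>
  define S where "S = nbrs E a \<union> nbrs E b"
  define E' where "E' = {e \<in> E. e \<inter> S = {}}"
  have S: "finite S" "a \<in> S" "b \<in> S"
    using ab finite_nbrs[OF fin] by (simp_all add: S_def) (simp_all add: nbrs_def insert_commute)
  have "card S \<le> card (nbrs E a) + card (nbrs E b)"
    unfolding S_def by (rule card_Un_le)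
  also have "\<dots> \<le> 2 * d"
    using deg by (metis add_mono mult_2)
  finally have "card S \<le> 2 * d" .
  then have "card {e \<in> E. e \<inter> S \<noteq> {}} \<le> 2 * d * d"
    using card_edges_meeting_le[OF fin card2 deg S(1)] by (meson le_trans mult_le_mono1)
  moreover have "card E = card E' + card {e \<in> E. e \<inter> S \<noteq> {}}"
    unfolding E'_def using fin by (subst card_Un_disjoint[symmetric]) (auto intro: arg_cong[where f = card])
  ultimately have "r * (2 * d * d + 1) \<le> card E'"
    using Suc.prems(4) by simp
  moreover have "card (nbrs E' v) \<le> d" for v
  proof -
    have "nbrs E' v \<subseteq> nbrs E v"
      by (auto simp: nbrs_def E'_def)
    then show ?thesis
      using deg finite_nbrs[OF fin] by (meson card_mono le_trans)
  qed
  ultimately obtain M where M: "M \<subseteq> E'" "card M = r" "disjoint M" "edges_inside E' (\<Union>M) = M"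
    using Suc.IH[of E'] fin card2 by (auto simp: E'_def)
  have off: "\<Union>M \<inter> S = {}"
    using M(1) by (auto simp: E'_def)
  let ?M = "insert {a, b} M"
  have "{a, b} \<notin> M"
    using off S by auto
  moreover have "finite M"
    by (rule rev_finite_subset[OF fin]) (use M(1) in \<open>auto simp: E'_def\<close>)
  ultimately have "card ?M = Suc r"
    using M(2) by simp
  moreover have "disjoint ?M"
    using M(3) off S by (auto simp: pairwise_insert disjnt_def)
  moreover have "edges_inside E (\<Union>?M) = ?M"
  proof
    have "M \<subseteq> E"
      using M(1) by (auto simp: E'_def)
    then show "?M \<subseteq> edges_inside E (\<Union>?M)"
      using ab by (auto simp: edges_inside_def)
    show "edges_inside E (\<Union>?M) \<subseteq> ?M"
    proof
      fix e assume "e \<in> edges_inside E (\<Union>?M)"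
      then have e: "e \<in> E" "e \<subseteq> {a, b} \<union> \<Union>M"
        by (auto simp: edges_inside_def)
      then obtain x y where xy: "e = {x, y}" "x \<noteq> y"
        using card2 by (metis card_2_iff)
      show "e \<in> ?M"
      \<comment> \<open>An edge touching \<open>a\<close> or \<open>b\<close> has its other end in
        \<open>S\<close>. As \<open>\<Union>M\<close> avoids \<open>S\<close>, such an edge cannot
        reach the rest of the matching.\<close>
      proof (cases "x \<in> {a, b} \<or> y \<in> {a, b}")
        case True
        then have "x \<in> S \<and> y \<in> S"
          using xy e S by (auto simp: S_def nbrs_def insert_commute)
        then have "e \<subseteq> {a, b}"
          using e off xy by auto
        then show ?thesis
          using xy by auto
      next
        case False
        then have "e \<subseteq> \<Union>M"
          using xy e by auto
        moreover from this have "e \<in> E'"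
          using e off by (auto simp: E'_def)
        ultimately show ?thesis
          using M(4) by (auto simp: edges_inside_def)
      qed
    qed
  qed
  moreover have "?M \<subseteq> E"
    using ab M(1) by (auto simp: E'_def)
  ultimately show ?case
    by blast
qed

section \<open>Bounds on cliques and degrees in the absence of induced stars\<close>

lemma clique_card_le_without_stars:
  assumes compl: "\<forall>x\<in>V. \<forall>y\<in>V. x \<noteq> y \<longrightarrow> ({x, y} \<in> F \<longleftrightarrow> {x, y} \<notin> E)"
    and noE: "\<forall>v\<in>V. \<forall>L\<subseteq>V. \<not> induced_star t E v L"
    and noF: "\<forall>v\<in>V. \<forall>L\<subseteq>V. \<not> induced_star t F v L"
    and A: "A \<subseteq> V" "clique A F" "finite A" "t * t \<le> card A" and "t > 0"
    and D: "D \<subseteq> V" "clique D E" "finite D"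
  shows "card D \<le> t"
proof (rule ccontr)
  assume "\<not> card D \<le> t"
  \<comment> \<open>Two common vertices would be joined in both colours. Hence a clique
    \<open>D\<close> with more than \<open>t\<close> vertices keeps at least \<open>t\<close> of
    them outside \<open>A\<close>.\<close>
  have "card (D \<inter> A) \<le> Suc 0"
  proof (subst card_le_Suc0_iff_eq, use D in simp, intro ballI, rule ccontr)
    fix x y assume "x \<in> D \<inter> A" "y \<in> D \<inter> A" "x \<noteq> y"
    then show False
      using A(1,2) D(2) compl unfolding clique_def by blast
  qed
  then have "t \<le> card (D - A)"
    using D(3) \<open>\<not> card D \<le> t\<close> by (simp add: card_Diff_subset_Int)
  then obtain D' where D': "D' \<subseteq> D - A" "card D' = t" "finite D'"
    using obtain_subset_with_card_n by metis
  \<comment> \<open>The clique \<open>A\<close> of colour \<open>F\<close> has no edge in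
    \<open>E\<close>, so \<open>t\<close> neighbours of \<open>v\<close> in \<open>A\<close> would
    be the leaves of an induced star in \<open>E\<close>.\<close>
  have deg: "card (nbrs E v \<inter> A) \<le> t - 1" if "v \<in> V" "v \<notin> A" for v
  proof (rule ccontr)
    assume "\<not> card (nbrs E v \<inter> A) \<le> t - 1"
    then have "t \<le> card (nbrs E v \<inter> A)"
      by simp
    then obtain L where L: "L \<subseteq> nbrs E v \<inter> A" "card L = t"
      using obtain_subset_with_card_n by metis
    moreover have "indep L E"
      using L A(1,2) compl by (auto simp: indep_def clique_def subset_iff)
    ultimately have "induced_star t E v L"
      using that by (auto simp: induced_star_def)
    then show False
      using noE that(1) L(1) A(1) by blast
  qed
  \<comment> \<open>Union bound: \<open>t\<close> sets of at most \<open>t - 1\<close> vertices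
    cannot cover the \<open>t * t\<close> vertices of \<open>A\<close>. An uncovered vertex
    \<open>a\<close> is joined to all of \<open>D'\<close> in colour \<open>F\<close> and becomes
    the centre of a star.\<close>
  have "card (\<Union>v\<in>D'. nbrs E v \<inter> A) \<le> (\<Sum>v\<in>D'. card (nbrs E v \<inter> A))"
    using D'(3) by (rule card_UN_le)
  also have "\<dots> \<le> (\<Sum>v\<in>D'. t - 1)"
    using D' D(1) by (intro sum_mono deg) auto
  also have "\<dots> < t * t"
    using D'(2) \<open>t > 0\<close> by simp
  also have "\<dots> \<le> card A"
    by (rule A(4))
  finally have "\<not> A \<subseteq> (\<Union>v\<in>D'. nbrs E v \<inter> A)"
    using A(3) D'(3) by (metis (no_types, lifting) card_mono finite_Int finite_UN_I not_le)
  then obtain a where a: "a \<in> A" "\<And>v. v \<in> D' \<Longrightarrow> {v, a} \<notin> E"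
    by (auto simp: nbrs_def)
  have "{a, v} \<in> F" if "v \<in> D'" for v
  proof -
    have "v \<in> V" "a \<in> V" "v \<noteq> a"
      using that D' D(1) A(1) a(1) by auto
    then show ?thesis
      using compl a(2)[OF that] by (metis insert_commute)
  qed
  moreover have "indep D' F"
    unfolding indep_def
  proof (intro ballI impI)
    fix x y assume xy: "x \<in> D'" "y \<in> D'" "x \<noteq> y"
    then have "x \<in> D" "y \<in> D"
      using D'(1) by auto
    then show "{x, y} \<notin> F"
      using xy(3) D(1,2) compl unfolding clique_def by blast
  qed
  ultimately have "induced_star t F a D'"
    using D' a(1) by (auto simp: induced_star_def nbrs_def)
  then show False
    using noF a(1) A(1) D' D(1) by blast
qed

text \<open>Ramsey's theorem is applied inside one neighbourhood: a clique on \<open>t + 1\<close>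
  vertices contradicts the preceding clique bound, and \<open>t\<close> independent vertices are the
  leaves of a star at \<open>v\<close>. The Ramsey property is a hypothesis so that \<open>d\<close>
  can be fixed before the colouring.\<close>

lemma degree_le_without_stars:
  fixes V :: "'a set"
  assumes ramsey: "\<forall>(V::'a set) E. finite V \<and> d \<le> card V \<longrightarrow>
      (\<exists>X\<subseteq>V. card X = Suc t \<and> clique X E \<or> card X = t \<and> indep X E)"
    and fin: "finite V" and sub: "E \<subseteq> Pow V" and card2: "\<forall>e\<in>E. card e = 2"
    and compl: "\<forall>x\<in>V. \<forall>y\<in>V. x \<noteq> y \<longrightarrow> ({x, y} \<in> F \<longleftrightarrow> {x, y} \<notin> E)"
    and noE: "\<forall>v\<in>V. \<forall>L\<subseteq>V. \<not> induced_star t E v L"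
    and noF: "\<forall>v\<in>V. \<forall>L\<subseteq>V. \<not> induced_star t F v L"
    and A: "A \<subseteq> V" "clique A F" "t * t \<le> card A" and "t > 0"
  shows "card (nbrs E v) \<le> d"
proof (rule ccontr)
  assume "\<not> card (nbrs E v) \<le> d"
  then have big: "d \<le> card (nbrs E v)" "nbrs E v \<noteq> {}"
    by auto
  \<comment> \<open>A neighbour supplies an edge through \<open>v\<close>, which puts
    \<open>v\<close> into \<open>V\<close>; this is why the degree bound needs no restriction on
    \<open>v\<close>.\<close>
  have NV: "nbrs E v \<subseteq> V" "v \<in> V" "v \<notin> nbrs E v"
    using sub card2 big(2) by (auto simp: nbrs_def)
  have finN: "finite (nbrs E v)"
    using NV(1) fin by (rule finite_subset)
  obtain X where X: "X \<subseteq> nbrs E v" "card X = Suc t \<and> clique X E \<or> card X = t \<and> indep X E"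
    using ramsey finN big(1) by blast
  have XV: "X \<subseteq> V"
    using X(1) NV(1) by blast
  show False
    using X(2)
  proof
    assume "card X = Suc t \<and> clique X E"
    then show False
      using clique_card_le_without_stars[OF compl noE noF A(1,2) _ A(3) \<open>t > 0\<close> XV]
        fin A(1) XV by (metis Suc_n_not_le_n finite_subset)
  next
    assume "card X = t \<and> indep X E"
    then have "induced_star t E v X"
      using X(1) NV(3) by (auto simp: induced_star_def)
    then show False
      using noE NV(2) XV by blast
  qed
qed

section \<open>Choice of the constants and the conclusion for both colours\<close>

theorem theorem2p9:
  fixes r t :: nat
  assumes "r \<ge> 2" and "t \<ge> 2"
  shows "\<exists>C::nat. \<exists>N::nat. \<forall>n\<ge>N. \<forall>R B.
           two_edge_coloring n R B \<longrightarrow> C \<le> card R \<longrightarrow> C \<le> card B \<longrightarrow>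
           \<not> contains_induced_mono n R B (matching_graph r) \<longrightarrow>
           contains_induced_mono n R B (star_graph t)"
proof -
  have "t > 0"
    using \<open>t \<ge> 2\<close> by simp
  obtain d where d: "\<forall>(V::nat set) E. finite V \<and> d \<le> card V \<longrightarrow>
      (\<exists>X\<subseteq>V. card X = Suc t \<and> clique X E \<or> card X = t \<and> indep X E)"
    using ramsey2[of "Suc t" t] by blast
  \<comment> \<open>The clique size \<open>t * t\<close> is what the union bound over
    \<open>t\<close> outside vertices requires.\<close>
  obtain N where N: "\<And>(V::nat set) E. finite V \<Longrightarrow> N \<le> card V \<Longrightarrow>
      \<exists>X\<subseteq>V. card X = t * t \<and> clique X E \<or> card X = t * t \<and> indep X E"
    using ramsey2[of "t * t" "t * t"] by metis
  \<comment> \<open>This many edges with degrees at most \<open>d\<close> force an induced matching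
    of size \<open>r\<close>; \<open>d\<close> depends on \<open>t\<close> alone.\<close>
  let ?C = "r * (2 * d * d + 1)"
  show ?thesis
  proof (rule exI[of _ ?C], rule exI[of _ N], intro allI impI, rule ccontr)
    fix n R B
    assume "N \<le> n" and col: "two_edge_coloring n R B"
      and CR: "?C \<le> card R" and CB: "?C \<le> card B"
      and nomatch: "\<not> contains_induced_mono n R B (matching_graph r)"
      and nostar: "\<not> contains_induced_mono n R B (star_graph t)"
    let ?V = "{..<n}"
    have RB: "R \<union> B = {e. e \<subseteq> ?V \<and> card e = 2}" "R \<inter> B = {}"
      using col by (auto simp: two_edge_coloring_def complete_graph_def)
    have sub: "E \<subseteq> Pow ?V" "\<forall>e\<in>E. card e = 2" "finite E" if "E = R \<or> E = B" for E
    proof -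
      show "E \<subseteq> Pow ?V" "\<forall>e\<in>E. card e = 2"
        using RB(1) that by auto
      then show "finite E"
        by (meson finite_Pow_iff finite_lessThan finite_subset)
    qed
    have "{x, y} \<in> R \<union> B" if "x \<in> ?V" "y \<in> ?V" "x \<noteq> y" for x y
      using RB(1) that by auto
    then have compl: "\<forall>x\<in>?V. \<forall>y\<in>?V. x \<noteq> y \<longrightarrow> ({x, y} \<in> R \<longleftrightarrow> {x, y} \<notin> B)"
      using RB(2) by blast
    have star: "\<forall>v\<in>?V. \<forall>L\<subseteq>?V. \<not> induced_star t E v L" if E: "E = R \<or> E = B" for E
    proof (intro ballI allI impI notI)
      fix v L assume "v \<in> ?V" "L \<subseteq> ?V" and vL: "induced_star t E v L"
      then have "insert v L \<subseteq> verts (complete_graph n)"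
        by (simp add: complete_graph_def)
      moreover note induced_star_isomorphic[OF vL \<open>t > 0\<close> sub(2)[OF E]]
      ultimately show False
        using nostar E unfolding contains_induced_mono_def by blast
    qed
    \<comment> \<open>A clique in one colour limits the number of edges of the other. Both
      assignments of the colours are covered, since Ramsey's theorem does not say which colour has
      the clique.\<close>
    have few: "card E < ?C"
      if EF: "E = R \<and> F = B \<or> E = B \<and> F = R" and A: "A \<subseteq> ?V" "card A = t * t" "clique A F"
      for E F A
    proof (rule ccontr)
      assume "\<not> card E < ?C"
      have E: "E = R \<or> E = B" and F: "F = R \<or> F = B"
        using EF by auto
      have "\<forall>x\<in>?V. \<forall>y\<in>?V. x \<noteq> y \<longrightarrow> ({x, y} \<in> F \<longleftrightarrow> {x, y} \<notin> E)"
        using compl EF by blast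
      then have "card (nbrs E v) \<le> d" for v
        by (rule degree_le_without_stars[OF d finite_lessThan sub(1,2)[OF E] _ star[OF E]
              star[OF F] A(1,3) _ \<open>t > 0\<close>]) (simp_all add: A(2))
      then obtain M where M: "M \<subseteq> E" "card M = r" "disjoint M" "edges_inside E (\<Union>M) = M"
        using ex_induced_matching[OF sub(3,2)[OF E], of d r] \<open>\<not> card E < ?C\<close> by (auto simp: not_less)
      have "finite M"
        using M(1) sub(3)[OF E] by (rule finite_subset)
      moreover have "\<forall>e\<in>M. card e = 2"
        using M(1) sub(2)[OF E] by blast
      ultimately have "card (\<Union>M) = card (verts (matching_graph r))"
        "graph_isomorphic (\<Union>M, edges_inside E (\<Union>M)) (matching_graph r)"
        using induced_matching_isomorphic M(2-4) by blast+
      moreover have "\<Union>M \<subseteq> verts (complete_graph n)"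
        using M(1) sub(1)[OF E] by (auto simp: complete_graph_def)
      ultimately show False
        using nomatch E unfolding contains_induced_mono_def by blast
    qed
    obtain X where X: "X \<subseteq> ?V" "card X = t * t" "clique X R \<or> indep X R"
      using N[of ?V R] \<open>N \<le> n\<close> by auto
    moreover have "clique X B" if "indep X R"
      using that X(1) compl by (auto simp: clique_def indep_def subset_iff)
    ultimately show False
      using few[of B R X] few[of R B X] CR CB by auto
  qed
qed

end
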